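(* For every integer $m\geq 2$ there exists a minimal $m$-IET $T$ defined by a separating permutation such that $T$ has an $n^{th}$ root in $\mathbb{G}$ for some $n\ge 2$ and $\operatorname{rank}(T)=1+\lfloor m/2\rfloor$.
   Context: Interval exchange transformations (IETs): fix $m\in\mathbb{N}$, $m\ge 1$, a permutation $\pi\in S_m$ of $\{1,\dots,m\}$, and $\lambda=(\lambda_1,\dots,\lambda_m)$ with $\lambda_i>0$ and $\sum_i\lambda_i=1$. Put $\beta_0=0$, $\beta_j=\lambda_1+\cdots+\lambda_j$, and $I_j=[\beta_{j-1},\beta_j)$ for $1\le j\le m$. The $m$-IET $T_{(\pi,\lambda)}:[0,1)\to[0,1)$ (defined by $\pi$) is the bijection given by $T_{(\pi,\lambda)}(x)=x-\sum_{i<j}\lambda_i+\sum_{\pi(i)<\pi(j)}\lambda_i$ for $x\in I_j$. The set of all IETs forms a group $\mathbb{G}$ under composition. $T$ is minimal if every orbit $\{T^k(x):k\in\mathbb{Z}\}$ is dense in $[0,1)$. $T$ has an $n^{th}$ root in $\mathbb{G}$ if there is $S\in\mathbb{G}$ with $T=S^n$ ($n$-fold composition). A permutation $\pi\in S_m$ is separating if $\pi(i+1)\ne\pi(i)+1$ for $1\le i\le m-1$. Rank: if $\gamma_1<\cdots<\gamma_{r-1}$ are the points at which an IET $T$ is discontinuous, $\gamma_0=0$, $\gamma_r=1$, and $l_j=\gamma_j-\gamma_{j-1}$ for $1\le j\le r$, then $\operatorname{rank}(T)$ is the dimension of the $\mathbb{Q}$-vector space spanned by $l_1,\dots,l_r$.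 *)

theory Defs
  imports "HOL-Analysis.Analysis" "HOL-Combinatorics.Permutations"
begin

definition iet_data :: "nat \<Rightarrow> (nat \<Rightarrow> nat) \<Rightarrow> (nat \<Rightarrow> real) \<Rightarrow> bool" where
  "iet_data m \<pi> lam \<longleftrightarrow>
     m \<ge> 1 \<and> \<pi> permutes {1..m} \<and> (\<forall>i\<in>{1..m}. lam i > 0) \<and> (\<Sum>i=1..m. lam i) = 1"

definition iet_beta :: "(nat \<Rightarrow> real) \<Rightarrow> nat \<Rightarrow> real" where
  "iet_beta lam j = (\<Sum>i=1..j. lam i)"

definition iet_interval :: "(nat \<Rightarrow> real) \<Rightarrow> nat \<Rightarrow> real set" where
  "iet_interval lam j = {iet_beta lam (j - 1)..<iet_beta lam j}"

text \<open>Self-maps of \<open>[0,1)\<close> are represented as functions on the reals that are the identity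
  outside \<open>[0,1)\<close>. Hence equality and composition of functions, \<open>inv\<close> and \<open>^^\<close> agree with
  the corresponding notions for bijections of \<open>[0,1)\<close>.\<close>

definition iet :: "nat \<Rightarrow> (nat \<Rightarrow> nat) \<Rightarrow> (nat \<Rightarrow> real) \<Rightarrow> real \<Rightarrow> real" where
  "iet m \<pi> lam x =
     (if x \<in> {0..<1} then
        (let j = (THE j. j \<in> {1..m} \<and> x \<in> iet_interval lam j)
         in x - (\<Sum>i\<in>{i\<in>{1..m}. i < j}. lam i) + (\<Sum>i\<in>{i\<in>{1..m}. \<pi> i < \<pi> j}. lam i))
      else x)"

definition IETs :: "(real \<Rightarrow> real) set" where
  "IETs = {iet m \<pi> lam | m \<pi> lam. iet_data m \<pi> lam}"

definition separating :: "nat \<Rightarrow> (nat \<Rightarrow> nat) \<Rightarrow> bool" where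
  "separating m \<pi> \<longleftrightarrow> (\<forall>i. 1 \<le> i \<and> i \<le> m - 1 \<longrightarrow> \<pi> (i + 1) \<noteq> \<pi> i + 1)"

definition int_iterate :: "('a \<Rightarrow> 'a) \<Rightarrow> int \<Rightarrow> 'a \<Rightarrow> 'a" where
  "int_iterate T k = (if k \<ge> 0 then T ^^ nat k else inv T ^^ nat (- k))"

definition minimal_iet :: "(real \<Rightarrow> real) \<Rightarrow> bool" where
  "minimal_iet T \<longleftrightarrow>
     (\<forall>x\<in>{0..<1}. {0..<1} \<subseteq> closure (range (\<lambda>k::int. int_iterate T k x)))"

definition has_root :: "nat \<Rightarrow> (real \<Rightarrow> real) \<Rightarrow> bool" where
  "has_root n T \<longleftrightarrow> (\<exists>S\<in>IETs. T = S ^^ n)"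

text \<open>Continuity is that of a map on the space \<open>[0,1)\<close>; in particular an interval exchange
  is continuous at \<open>0\<close>.\<close>

definition discontinuities :: "(real \<Rightarrow> real) \<Rightarrow> real set" where
  "discontinuities T = {x\<in>{0..<1}. \<not> continuous (at x within {0..<1}) T}"

text \<open>The list \<open>\<gamma>\<^sub>0, \<dots>, \<gamma>\<^sub>r\<close>; the set of discontinuities is finite for every
  interval exchange.\<close>

definition iet_gammas :: "(real \<Rightarrow> real) \<Rightarrow> real list" where
  "iet_gammas T = 0 # sorted_list_of_set (discontinuities T) @ [1]"

definition iet_lengths :: "(real \<Rightarrow> real) \<Rightarrow> real set" where
  "iet_lengths T =
     {iet_gammas T ! j - iet_gammas T ! (j - 1) | j. 1 \<le> j \<and> j < length (iet_gammas T)}"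

interpretation rat_real: vector_space "\<lambda>(q::rat) (x::real). of_rat q * x"
  by unfold_locales (simp_all add: algebra_simps of_rat_add of_rat_mult)

definition iet_rank :: "(real \<Rightarrow> real) \<Rightarrow> nat" where
  "iet_rank T = rat_real.dim (rat_real.span (iet_lengths T))"

end

theory Submission
  imports Defs
begin

text \<open>Cut \<open>[0,1)\<close> into \<open>N\<close> blocks of length \<open>1/N\<close>, and let \<open>T\<close> send block \<open>j\<close> to block
  \<open>j + 1\<close> modulo \<open>N\<close>, rotating it by \<open>a\<^sub>j\<close> (in units of the block length) on the way. Then
  \<open>T\<^sup>N\<close> rotates every block by \<open>A = \<Sum>a\<^sub>j\<close>, so \<open>T\<close> is minimal once \<open>A\<close> is irrational. Lowering
  every angle by \<open>A/(N+1)\<close> gives an \<open>(N+1)\<close>-st root of \<open>T\<close>: its \<open>(N+1)\<close>-st iterate visits all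
  blocks once and the starting block \<open>j\<close> twice, for a total angle of
  \<open>A + a\<^sub>j - (N+1) A/(N+1) = a\<^sub>j\<close>. If \<open>1, a\<^sub>0, \<dots>, a\<^sub>N\<^sub>-\<^sub>1\<close> are rationally independent, \<open>T\<close> exchanges
  \<open>2N\<close> intervals and has rank \<open>N + 1\<close>; taking \<open>a\<^sub>N\<^sub>-\<^sub>1 = 0\<close> instead loses one interval and one
  dimension, which covers odd \<open>m = 2N - 1\<close>.\<close>

subsection \<open>Interval exchanges\<close>

lemma iet_beta_0 [simp]: "iet_beta lam 0 = 0"
  by (simp add: iet_beta_def)

lemma iet_beta_Suc: "iet_beta lam (Suc j) = iet_beta lam j + lam (Suc j)"
  by (simp add: iet_beta_def)

lemma iet_beta_top: "iet_data m \<pi> lam \<Longrightarrow> iet_beta lam m = 1"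
  by (simp add: iet_data_def iet_beta_def)

lemma iet_beta_strict_mono:
  assumes "iet_data m \<pi> lam" "i < j" "j \<le> m"
  shows "iet_beta lam i < iet_beta lam j"
  using assms(2,3)
proof (induction j)
  case (Suc j)
  have "lam (Suc j) > 0"
    using assms(1) Suc.prems by (auto simp: iet_data_def)
  with Suc show ?case
    by (cases "i = j") (auto simp: iet_beta_Suc less_Suc_eq)
qed simp

lemma iet_beta_mono:
  assumes "iet_data m \<pi> lam" "i \<le> j" "j \<le> m"
  shows "iet_beta lam i \<le> iet_beta lam j"
  using iet_beta_strict_mono[OF assms(1)] assms(2,3) by (cases "i = j") (auto simp: less_le)

lemma iet_interval_unique:
  assumes "iet_data m \<pi> lam" "i \<in> {1..m}" "j \<in> {1..m}"
    and "x \<in> iet_interval lam i" "x \<in> iet_interval lam j"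
  shows "i = j"
proof (rule ccontr)
  have *: False if "i \<in> {1..m}" "j \<in> {1..m}" "x \<in> iet_interval lam i" "x \<in> iet_interval lam j" "i < j" for i j
  proof -
    have "iet_beta lam i \<le> iet_beta lam (j - 1)"
      using that by (intro iet_beta_mono[OF assms(1)]) auto
    with that show False
      by (simp add: iet_interval_def)
  qed
  assume "i \<noteq> j"
  then show False
    using *[of i j] *[of j i] assms(2-) by linarith
qed

lemma iet_interval_cover:
  assumes "iet_data m \<pi> lam" "x \<in> {0..<1}"
  obtains j where "j \<in> {1..m}" "x \<in> iet_interval lam j"
proof -
  define j where "j = (LEAST j. x < iet_beta lam j)"
  have m: "x < iet_beta lam m"
    using assms by (simp add: iet_beta_top)
  have j: "x < iet_beta lam j"
    unfolding j_def using m by (rule LeastI)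
  have "j \<le> m"
    unfolding j_def using m by (rule Least_le)
  moreover have "j \<noteq> 0"
    using j assms(2) by (cases j) auto
  moreover from this have "\<not> x < iet_beta lam (j - 1)"
    unfolding j_def by (intro not_less_Least) (simp add: j_def)
  ultimately show ?thesis
    using j by (intro that[of j]) (auto simp: iet_interval_def)
qed

lemma iet_interval_subset:
  assumes "iet_data m \<pi> lam" "j \<in> {1..m}"
  shows "iet_interval lam j \<subseteq> {0..<1}"
proof -
  have "iet_beta lam 0 \<le> iet_beta lam (j - 1)" "iet_beta lam j \<le> iet_beta lam m"
    using assms(2) by (intro iet_beta_mono[OF assms(1)]; auto)+
  then show ?thesis
    by (auto simp: iet_interval_def iet_beta_top[OF assms(1)])
qed

lemma iet_on_interval:
  assumes "iet_data m \<pi> lam" "j \<in> {1..m}" "x \<in> iet_interval lam j"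
  shows "iet m \<pi> lam x = x - iet_beta lam (j - 1) + (\<Sum>i\<in>{i\<in>{1..m}. \<pi> i < \<pi> j}. lam i)"
proof -
  have "x \<in> {0..<1}"
    using iet_interval_subset[OF assms(1,2)] assms(3) by blast
  moreover have "(THE j. j \<in> {1..m} \<and> x \<in> iet_interval lam j) = j"
    using assms iet_interval_unique[OF assms(1)] by (intro the_equality) blast+
  moreover have "{i\<in>{1..m}. i < j} = {1..j - 1}"
    using assms(2) by auto
  ultimately show ?thesis
    by (simp add: iet_def iet_beta_def)
qed

section \<open>Discontinuities, lengths and rank of an interval exchange\<close>

text \<open>The left limit at the partition point is the right end of the image of interval
  \<open>j\<close>; the value there is the left end of the image of interval \<open>j + 1\<close>.
  As lengths are positive, the two agree only if the images are adjacent in this order, which a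
  separating permutation forbids.\<close>

lemma iet_discontinuous_at_beta:
  assumes iet: "iet_data m \<pi> lam" and sep: "separating m \<pi>" and j: "1 \<le> j" "j < m"
  shows "\<not> continuous (at (iet_beta lam j) within {0..<1}) (iet m \<pi> lam)"
proof
  let ?b = "iet_beta lam j" and ?a = "iet_beta lam (j - 1)" and ?T = "iet m \<pi> lam"
  let ?L = "\<lambda>j. \<Sum>i\<in>{i\<in>{1..m}. \<pi> i < \<pi> j}. lam i"
  assume "continuous (at ?b within {0..<1}) ?T"
  then have lim: "(?T \<longlongrightarrow> ?T ?b) (at ?b within {0..<1})"
    by (simp add: continuous_within)
  have ab: "?a < ?b"
    using iet_beta_strict_mono[OF iet, of "j - 1" j] j by simp
  have sub: "{?a<..<?b} \<subseteq> iet_interval lam j"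
    by (auto simp: iet_interval_def)
  then have "{?a<..<?b} \<subseteq> {0..<1}"
    using iet_interval_subset[OF iet, of j] j by auto
  with lim have "(?T \<longlongrightarrow> ?T ?b) (at ?b within {?a<..<?b})"
    by (rule tendsto_within_subset)
  moreover have "\<forall>\<^sub>F x in at ?b within {?a<..<?b}. ?T x = x - ?a + ?L j"
    unfolding eventually_at_filter
    using iet_on_interval[OF iet, of j] j sub by (intro always_eventually) auto
  ultimately have "((\<lambda>x. x - ?a + ?L j) \<longlongrightarrow> ?T ?b) (at ?b within {?a<..<?b})"
    by (rule Lim_transform_eventually)
  moreover have "((\<lambda>x. x - ?a + ?L j) \<longlongrightarrow> ?b - ?a + ?L j) (at ?b within {?a<..<?b})"
    by (intro tendsto_intros)
  moreover have "at ?b within {?a<..<?b} = at_left ?b"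
    using ab by (intro at_within_nhd[of _ "{?a<..}"]) auto
  then have "at ?b within {?a<..<?b} \<noteq> bot"
    by simp
  ultimately have T1: "?T ?b = ?b - ?a + ?L j"
    using tendsto_unique by blast
  have "?b \<in> iet_interval lam (Suc j)"
    using iet_beta_strict_mono[OF iet, of j "Suc j"] j by (auto simp: iet_interval_def)
  then have T2: "?T ?b = ?L (Suc j)"
    using iet_on_interval[OF iet, of "Suc j" ?b] j by simp
  have perm: "\<pi> permutes {1..m}" and pos: "\<And>i. i \<in> {1..m} \<Longrightarrow> lam i > 0"
    using iet by (auto simp: iet_data_def)
  have "?b - ?a = lam j"
    using iet_beta_Suc[of lam "j - 1"] j by simp
  moreover have "{i\<in>{1..m}. \<pi> i \<le> \<pi> j} = insert j {i\<in>{1..m}. \<pi> i < \<pi> j}"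
    using j permutes_inj[OF perm] by (auto simp: le_less dest: injD)
  ultimately have T3: "?b - ?a + ?L j = (\<Sum>i\<in>{i\<in>{1..m}. \<pi> i \<le> \<pi> j}. lam i)"
    by simp
  have eq: "(\<Sum>i\<in>{i\<in>{1..m}. \<pi> i \<le> \<pi> j}. lam i) = ?L (Suc j)"
    using T1 T2 T3 by simp
  have ne: "\<pi> (Suc j) \<noteq> Suc (\<pi> j)"
    using sep j by (auto simp: separating_def)
  show False
  \<comment> \<open>The two index sets are nested and distinct: they differ in \<open>j\<close>
    itself in the first case, in the preimage of \<open>Suc (\<pi> j)\<close> in the second.\<close>
  proof (cases "\<pi> (Suc j) \<le> \<pi> j")
    case True
    have "?L (Suc j) < (\<Sum>i\<in>{i\<in>{1..m}. \<pi> i \<le> \<pi> j}. lam i)"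
      using True j pos by (intro sum_strict_mono2[where b = j]) (auto intro: less_imp_le)
    with eq show False by simp
  next
    case False
    with ne have gt: "\<pi> (Suc j) > Suc (\<pi> j)"
      by simp
    have "\<pi> (Suc j) \<in> {1..m}"
      using permutes_in_image[OF perm, of "Suc j"] j by auto
    then have "Suc (\<pi> j) \<in> {1..m}"
      using gt by auto
    then obtain i where i: "i \<in> {1..m}" "\<pi> i = Suc (\<pi> j)"
      using permutes_image[OF perm] by (metis imageE)
    have "(\<Sum>i\<in>{i\<in>{1..m}. \<pi> i \<le> \<pi> j}. lam i) < ?L (Suc j)"
      using gt i pos by (intro sum_strict_mono2[where b = i]) (auto intro: less_imp_le)
    with eq show False by simp
  qed
qed

lemma iet_continuous_off_beta:
  assumes iet: "iet_data m \<pi> lam" and x: "x \<in> {0..<1}" "x \<notin> iet_beta lam ` {1..<m}"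
  shows "continuous (at x within {0..<1}) (iet m \<pi> lam)"
proof -
  obtain j where j: "j \<in> {1..m}" and xj: "x \<in> iet_interval lam j"
    using iet_interval_cover[OF iet x(1)] .
  let ?a = "iet_beta lam (j - 1)" and ?b = "iet_beta lam j"
  \<comment> \<open>For \<open>j = 1\<close> the point may be the left end 0 itself; continuity is
    taken within \<open>{0..<1}\<close>, so any bound below \<open>x\<close> serves. For other
    \<open>j\<close> the point lies strictly inside the interval.\<close>
  have "\<exists>l<x. {l<..<?b} \<inter> {0..<1} \<subseteq> iet_interval lam j"
  proof (cases "j = 1")
    case True
    then show ?thesis
      using xj by (intro exI[of _ "x - 1"]) (auto simp: iet_interval_def)
  next
    case False
    then have "j - 1 \<in> {1..<m}"
      using j by auto
    then have "x \<noteq> ?a"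
      using x(2) by blast
    then show ?thesis
      using xj by (intro exI[of _ ?a]) (auto simp: iet_interval_def)
  qed
  then obtain l where l: "l < x" "{l<..<?b} \<inter> {0..<1} \<subseteq> iet_interval lam j"
    by blast
  have xb: "x < ?b"
    using xj by (simp add: iet_interval_def)
  show ?thesis
  proof (rule continuous_transform_within)
    show "continuous (at x within {0..<1})
        (\<lambda>x. x - ?a + (\<Sum>i\<in>{i\<in>{1..m}. \<pi> i < \<pi> j}. lam i))"
      by (intro continuous_intros)
    show "0 < min (x - l) (?b - x)"
      using l(1) xb by simp
    fix y assume y: "y \<in> {0..<1}" "dist y x < min (x - l) (?b - x)"
    then have "y \<in> {l<..<?b}"
      by (auto simp: dist_real_def)
    then show "y - ?a + (\<Sum>i\<in>{i\<in>{1..m}. \<pi> i < \<pi> j}. lam i) = iet m \<pi> lam y"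
      using iet_on_interval[OF iet j, of y] l(2) y(1) by auto
  qed (use x in simp)
qed

lemma discontinuities_iet:
  assumes "iet_data m \<pi> lam" "separating m \<pi>"
  shows "discontinuities (iet m \<pi> lam) = iet_beta lam ` {1..<m}"
proof -
  have "iet_beta lam j \<in> {0..<1}" if "j \<in> {1..<m}" for j
    using iet_beta_mono[OF assms(1), of 0 j] iet_beta_strict_mono[OF assms(1), of j m] that
      iet_beta_top[OF assms(1)] by simp
  then show ?thesis
    using iet_discontinuous_at_beta[OF assms] iet_continuous_off_beta[OF assms(1)]
    by (auto simp: discontinuities_def)
qed

text \<open>Every inner partition point is a genuine discontinuity, so \<open>iet_gammas\<close>
  lists exactly the partition points and the rank can be read off \<open>lam\<close>.\<close>

lemma iet_lengths_iet:
  assumes "iet_data m \<pi> lam" "separating m \<pi>"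
  shows "iet_lengths (iet m \<pi> lam) = lam ` {1..m}"
proof -
  let ?b = "iet_beta lam"
  have m: "m \<ge> 1"
    using assms(1) by (simp add: iet_data_def)
  have "sorted_wrt (<) (map ?b [1..<m])"
    using iet_beta_strict_mono[OF assms(1)] by (auto simp: sorted_wrt_iff_nth_less)
  then have "sorted_list_of_set (set (map ?b [1..<m])) = map ?b [1..<m]"
    by (intro sorted_list_of_set.idem_if_sorted_distinct) (auto simp: strict_sorted_iff)
  then have "iet_gammas (iet m \<pi> lam) = ?b 0 # map ?b [1..<m] @ [?b m]"
    using discontinuities_iet[OF assms] iet_beta_top[OF assms(1)] by (simp add: iet_gammas_def)
  also have "\<dots> = map ?b [0..<Suc m]"
    using m by (subst upt_rec) simp
  finally have g: "iet_gammas (iet m \<pi> lam) = map ?b [0..<Suc m]" .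
  have d: "?b j - ?b (j - 1) = lam j" if "1 \<le> j" for j
    using iet_beta_Suc[of lam "j - 1"] that by simp
  have "iet_lengths (iet m \<pi> lam) = {?b j - ?b (j - 1) | j. 1 \<le> j \<and> j < Suc m}"
    unfolding iet_lengths_def g
    by (intro Collect_cong ex_cong1 rev_conj_cong) (auto simp del: upt_Suc)
  also have "\<dots> = lam ` {1..m}"
    using d by (force simp: image_iff)
  finally show ?thesis .
qed

lemma iet_rank_iet:
  assumes "iet_data m \<pi> lam" "separating m \<pi>"
  shows "iet_rank (iet m \<pi> lam) = rat_real.dim (lam ` {1..m})"
  by (simp add: iet_rank_def iet_lengths_iet[OF assms] rat_real.dim_span)

subsection \<open>Block rotations\<close>

text \<open>A skew product over the cyclic shift of the blocks, with circle rotations in the fibres: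
  the floor of \<open>N * x\<close> is the block, its fractional part the position. Adding the angle
  to \<open>N * x\<close> itself is harmless, since \<open>frac\<close> discards the block
  number.\<close>

definition block_rot :: "nat \<Rightarrow> (nat \<Rightarrow> real) \<Rightarrow> real \<Rightarrow> real" where
  "block_rot N a x =
     (if x \<in> {0..<1} then
        (real (Suc (nat \<lfloor>real N * x\<rfloor>) mod N) + frac (real N * x + a (nat \<lfloor>real N * x\<rfloor>))) / real N
      else x)"

lemma block_coords:
  assumes "N > 0" "x \<in> {0..<1}"
  obtains j u where "j < N" "0 \<le> u" "u < 1" "x = (real j + u) / real N"
proof
  let ?j = "nat \<lfloor>real N * x\<rfloor>"
  have j: "real ?j = of_int \<lfloor>real N * x\<rfloor>"
    using assms by simp
  have "real N * x < real N"
    using assms by simp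
  then have "real ?j < real N"
    unfolding j by linarith
  then show "?j < N"
    by simp
  show "0 \<le> frac (real N * x)" "frac (real N * x) < 1"
    by (simp_all add: frac_lt_1)
  show "x = (real ?j + frac (real N * x)) / real N"
    unfolding j using assms by (simp add: frac_def)
qed

lemma block_coords_mem:
  assumes "j < N" "0 \<le> u" "u < 1"
  shows "(real j + u) / real N \<in> {0..<1}"
proof -
  have "real (Suc j) \<le> real N"
    using assms(1) by linarith
  then show ?thesis
    using assms by (simp add: field_simps)
qed

lemma block_rot_coords:
  assumes "j < N" "0 \<le> u" "u < 1"
  shows "block_rot N a ((real j + u) / real N) = (real (Suc j mod N) + frac (u + a j)) / real N"
proof -
  have x: "real N * ((real j + u) / real N) = real j + u"
    using assms by simp
  have j: "nat \<lfloor>real j + u\<rfloor> = j"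
    using assms by linarith
  have "frac (real j + u + a j) = frac (u + a j)"
    using frac_unique_iff[of "real j + u + a j" "frac (u + a j)"]
    by (simp add: frac_lt_1) (simp add: frac_def)
  then show ?thesis
    unfolding block_rot_def x j using block_coords_mem[OF assms] by simp
qed

lemma block_rot_funpow:
  assumes "j < N" "0 \<le> u" "u < 1"
  shows "(block_rot N a ^^ n) ((real j + u) / real N) =
    (real ((j + n) mod N) + frac (u + (\<Sum>i<n. a ((j + i) mod N)))) / real N"
proof (induction n)
  case 0
  then show ?case
    using assms by simp
next
  case (Suc n)
  have "(j + n) mod N < N"
    using assms by simp
  from block_rot_coords[OF this frac_ge_0 frac_lt_1, of a] Suc show ?case
    by (simp add: mod_Suc_eq add.assoc)
qed

lemma block_rot_outside: "x \<notin> {0..<1} \<Longrightarrow> (block_rot N a ^^ n) x = x"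
  by (induction n) (auto simp: block_rot_def)

text \<open>Angles matter only modulo 1. The lowered angles of the root may be negative; this brings
  them into \<open>[0,1)\<close>, where the block rotation can be written as an interval
  exchange.\<close>

lemma block_rot_frac: "block_rot N (\<lambda>j. frac (a j)) = block_rot N a"
  by (simp add: block_rot_def fun_eq_iff)

lemma sum_Suc_mod:
  fixes g :: "nat \<Rightarrow> 'a::comm_monoid_add"
  shows "(\<Sum>t<N. g (Suc t mod N)) = (\<Sum>t<N. g t)"
proof (cases N)
  case (Suc M)
  have "(\<Sum>t<M. g (Suc t mod N)) = (\<Sum>t<M. g (Suc t))"
    using Suc by (intro sum.cong) auto
  then show ?thesis
    unfolding Suc sum.lessThan_Suc_shift[of g] sum.lessThan_Suc[of "\<lambda>t. g (Suc t mod Suc M)"]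
    by (simp add: add.commute)
qed simp

text \<open>\<open>N\<close> consecutive residues meet every block once, so the angle of a full turn
  is the same from every starting block.\<close>

lemma sum_add_mod:
  fixes g :: "nat \<Rightarrow> 'a::comm_monoid_add"
  shows "(\<Sum>t<N. g ((j + t) mod N)) = (\<Sum>t<N. g t)"
proof (induction j)
  case (Suc j)
  have "(\<Sum>t<N. g ((Suc j + t) mod N)) = (\<Sum>t<N. g ((j + Suc t mod N) mod N))"
    by (simp add: mod_add_right_eq)
  also have "\<dots> = (\<Sum>t<N. g ((j + t) mod N))"
    by (rule sum_Suc_mod)
  finally show ?case
    using Suc by simp
qed (auto intro!: sum.cong)

lemma block_rot_root:
  assumes "\<And>j. j < N \<Longrightarrow> b j = a j - (\<Sum>i<N. a i) / real (Suc N)"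
  shows "block_rot N b ^^ Suc N = block_rot N a"
proof
  fix x
  show "(block_rot N b ^^ Suc N) x = block_rot N a x"
  proof (cases "N > 0 \<and> x \<in> {0..<1}")
    \<comment> \<open>This includes \<open>N = 0\<close>, where division by zero makes both sides 0
      on \<open>[0,1)\<close>.\<close>
    case False
    then show ?thesis
      using block_rot_outside[where N = N and a = b and n = "Suc N"] by (auto simp: block_rot_def)
  next
    case True
    then obtain j u where ju: "j < N" "0 \<le> u" "u < 1" and x: "x = (real j + u) / real N"
      using block_coords by blast
    \<comment> \<open>A full turn now contributes only \<open>A / (N + 1)\<close>, which is exactly
      what the second visit to block \<open>j\<close> lacks.\<close>
    have "(\<Sum>i<N. b i) = (\<Sum>i<N. a i) - real N * ((\<Sum>i<N. a i) / real (Suc N))"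
      by (simp add: assms sum_subtractf)
    also have "\<dots> = (\<Sum>i<N. a i) / real (Suc N)"
      by (simp add: field_simps)
    finally have "(\<Sum>i<Suc N. b ((j + i) mod N)) = b j + (\<Sum>i<N. a i) / real (Suc N)"
      using ju(1) by (simp add: sum_add_mod[of b])
    then have "(\<Sum>i<Suc N. b ((j + i) mod N)) = a j"
      using ju(1) by (simp add: assms)
    moreover have "(j + Suc N) mod N = Suc j mod N"
      by (metis add_Suc add_Suc_right mod_add_self2)
    ultimately show ?thesis
      unfolding x block_rot_funpow[OF ju] block_rot_coords[OF ju] by (simp only:)
  qed
qed

text \<open>The \<open>N\<close>-th iterate rotates each block by the irrational total angle, so its
  forward orbits are dense in the block. It remains to enter the block of the target point
  first.\<close>

lemma minimal_block_rot:
  assumes N: "N > 0" and irr: "(\<Sum>i<N. a i) \<notin> \<rat>"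
  shows "minimal_iet (block_rot N a)"
  unfolding minimal_iet_def
proof (intro ballI subsetI)
  let ?F = "block_rot N a" and ?A = "\<Sum>i<N. a i"
  fix x y :: real assume x: "x \<in> {0..<1}" and y: "y \<in> {0..<1}"
  obtain j u where ju: "j < N" "0 \<le> u" "u < 1" and x_eq: "x = (real j + u) / real N"
    using block_coords[OF N x] .
  obtain l v where lv: "l < N" "0 \<le> v" "v < 1" and y_eq: "y = (real l + v) / real N"
    using block_coords[OF N y] .
  \<comment> \<open>Steps leading from block \<open>j\<close> to block \<open>l\<close>; the added
    \<open>N\<close> keeps the number natural.\<close>
  define n where "n = l + (N - j)"
  have n: "(j + n) mod N = l"
    using ju lv by (simp add: n_def)
  define u' where "u' = frac (u + (\<Sum>i<n. a ((j + i) mod N)))"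
  have u': "0 \<le> u'" "u' < 1"
    by (simp_all add: u'_def frac_lt_1)
  have n_eq: "(?F ^^ n) x = (real l + u') / real N"
    unfolding x_eq block_rot_funpow[OF ju] n u'_def ..
  have return: "(?F ^^ (k * N)) ((real l + w) / real N) = (real l + frac (w + real k * ?A)) / real N"
    if "0 \<le> w" "w < 1" for w k
    using that
  proof (induction k arbitrary: w)
    case 0
    then show ?case
      by simp
  next
    case (Suc k)
    have "(?F ^^ N) ((real l + w) / real N) = (real l + frac (w + ?A)) / real N"
      using block_rot_funpow[OF lv(1) Suc.prems, where n = N] lv(1) by (simp add: sum_add_mod)
    then have "(?F ^^ (Suc k * N)) ((real l + w) / real N)
        = (?F ^^ (k * N)) ((real l + frac (w + ?A)) / real N)"
      by (simp add: funpow_add funpow_swap1 add.commute[of N])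
    also have "\<dots> = (real l + frac (w + real (Suc k) * ?A)) / real N"
      using Suc.IH[of "frac (w + ?A)"] by (simp add: frac_lt_1 algebra_simps)
    finally show ?case .
  qed
  show "y \<in> closure (range (\<lambda>k. int_iterate ?F k x))"
    unfolding closure_approachable
  proof (intro allI impI)
    fix e :: real assume "e > 0"
    \<comment> \<open>The orbit is steered to \<open>v + d\<close> instead of \<open>v\<close>: an
      error below \<open>d\<close> then leaves the position between \<open>v\<close> and
      \<open>v + 2 * d\<close>, within \<open>e\<close> of \<open>v\<close> and without wrapping
      around the block.\<close>
    define d where "d = min e (1 - v) / 2"
    have d: "d > 0" "2 * d \<le> 1 - v" "2 * d \<le> e"
      using \<open>e > 0\<close> lv by (auto simp: d_def min_def)
    obtain k where k: "\<bar>frac (real k * ?A) - frac (v + d - u')\<bar> < d"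
      using Kronecker_approx_1_explicit[OF irr frac_ge_0 less_imp_le[OF frac_lt_1] d(1)] by metis
    define r where "r = frac (real k * ?A) - frac (v + d - u')"
    have "frac (u' + real k * ?A) = v + d + r"
    proof (subst frac_unique_iff, intro conjI)
      have "u' + real k * ?A - (v + d + r) = of_int (\<lfloor>real k * ?A\<rfloor> - \<lfloor>v + d - u'\<rfloor>)"
        by (simp add: r_def frac_def)
      then show "u' + real k * ?A - (v + d + r) \<in> \<int>"
        by simp
    qed (use k d lv r_def in linarith)+
    then have "(?F ^^ (k * N + n)) x = (real l + (v + d + r)) / real N"
      using return[OF u', where k = k] n_eq by (simp add: funpow_add)
    moreover have "\<bar>(d + r) / real N\<bar> < e"
    proof -
      have "\<bar>d + r\<bar> < e"
        using k d r_def by linarith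
      moreover have "\<bar>d + r\<bar> / real N \<le> \<bar>d + r\<bar>"
        using N by (simp add: divide_le_eq mult_le_cancel_left1)
      ultimately show ?thesis
        by simp
    qed
    ultimately have "dist (int_iterate ?F (int (k * N + n)) x) y < e"
      by (simp add: int_iterate_def y_eq dist_real_def diff_divide_distrib[symmetric] nat_int del: of_nat_add of_nat_mult)
    then show "\<exists>z\<in>range (\<lambda>k. int_iterate ?F k x). dist z y < e"
      by blast
  qed
qed

section \<open>Block rotations as interval exchanges\<close>

text \<open>Rotating block \<open>t\<close> exchanges two pieces, of relative lengths
  \<open>1 - a t\<close> and \<open>a t\<close>. Indices start at 1, so these pieces have indices
  \<open>2 * t + 1\<close> and \<open>2 * t + 2\<close>.\<close>

definition block_len :: "nat \<Rightarrow> (nat \<Rightarrow> real) \<Rightarrow> nat \<Rightarrow> real" where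
  "block_len N a i = (if odd i then 1 - a ((i - 1) div 2) else a ((i - 1) div 2)) / real N"

text \<open>Both pieces move to the next block and swap their order there, hence the offset 2 for
  the odd index and 1 for the even one.\<close>

definition block_perm :: "nat \<Rightarrow> nat \<Rightarrow> nat" where
  "block_perm N i =
     (if i \<in> {1..2 * N} then 2 * (Suc ((i - 1) div 2) mod N) + (if odd i then 2 else 1) else i)"

lemma block_len_simps [simp]:
  "block_len N a (Suc (2 * t)) = (1 - a t) / real N"
  "block_len N a (Suc (Suc (2 * t))) = a t / real N"
  by (simp_all add: block_len_def)

lemma iet_beta_block_len: "iet_beta (block_len N a) (2 * t) = real t / real N"
proof (induction t)
  case (Suc t)
  have "iet_beta (block_len N a) (2 * Suc t) =
      iet_beta (block_len N a) (2 * t) + block_len N a (Suc (2 * t)) + block_len N a (Suc (Suc (2 * t)))"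
    by (simp add: iet_beta_Suc)
  then show ?case
    by (simp add: Suc add_divide_distrib[symmetric])
qed simp

lemma iet_beta_block_len_odd:
  "iet_beta (block_len N a) (Suc (2 * t)) = (real t + (1 - a t)) / real N"
  by (simp add: iet_beta_Suc iet_beta_block_len add_divide_distrib)

lemma block_index_cases:
  assumes "i \<in> {1..2 * N}"
  obtains t where "t < N" "i = Suc (2 * t)" | t where "t < N" "i = Suc (Suc (2 * t))"
proof (cases "odd i")
  case True
  then obtain t where "i = 2 * t + 1"
    by (rule oddE)
  with assms show ?thesis
    by (intro that(1)[of t]) auto
next
  case False
  then obtain t where "i = 2 * t"
    by auto
  with assms show ?thesis
    by (intro that(2)[of "t - 1"]) auto
qed

lemma block_perm_simps:
  assumes "t < N"
  shows "block_perm N (Suc (2 * t)) = 2 * (Suc t mod N) + 2"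
    and "block_perm N (Suc (Suc (2 * t))) = 2 * (Suc t mod N) + 1"
  using assms by (auto simp: block_perm_def)

lemma Suc_mod_inj:
  assumes "s < N" "t < N" "Suc s mod N = Suc t mod N"
  shows "s = t"
  using assms by (auto simp: mod_Suc split: if_splits)

lemma block_perm_permutes:
  assumes "N > 0"
  shows "block_perm N permutes {1..2 * N}"
proof (rule bij_imp_permutes)
  have "inj_on (block_perm N) {1..2 * N}"
  proof (rule inj_onI)
    fix i j assume i: "i \<in> {1..2 * N}" and j: "j \<in> {1..2 * N}" and eq: "block_perm N i = block_perm N j"
    have parity: "2 * p + 2 \<noteq> 2 * q + (1::nat)" "2 * p + (1::nat) \<noteq> 2 * q + 2" for p q
      by presburger+
    show "i = j"
      using i
    proof (cases rule: block_index_cases)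
      case 1
      from j show ?thesis
        by (cases rule: block_index_cases)
          (use 1 eq parity in \<open>auto simp: block_perm_simps simp del: One_nat_def dest: Suc_mod_inj\<close>)
    next
      case 2
      from j show ?thesis
        by (cases rule: block_index_cases)
          (use 2 eq parity in \<open>auto simp: block_perm_simps simp del: One_nat_def dest: Suc_mod_inj\<close>)
    qed
  qed
  moreover have "block_perm N ` {1..2 * N} \<subseteq> {1..2 * N}"
  proof
    fix k assume "k \<in> block_perm N ` {1..2 * N}"
    then obtain i where k: "k = block_perm N i" and i: "i \<in> {1..2 * N}"
      by blast
    have "Suc t mod N + 1 \<le> N" for t
      using assms by (simp add: Suc_le_eq)
    then have bound: "2 * (Suc t mod N) + 2 \<le> 2 * N" for t
      by (metis add_mult_distrib2 mult_le_mono2 nat_mult_1_right)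
    from i show "k \<in> {1..2 * N}"
    proof (cases rule: block_index_cases)
      case (1 t)
      then show ?thesis
        using bound[of t] by (simp add: k block_perm_simps)
    next
      case (2 t)
      then show ?thesis
        using bound[of t] by (simp add: k block_perm_simps)
    qed
  qed
  ultimately show "bij_betw (block_perm N) {1..2 * N} {1..2 * N}"
    using endo_inj_surj[of "{1..2 * N}"] by (simp add: bij_betw_def)
qed (auto simp: block_perm_def)

text \<open>Within a block the order is reversed. Across a block boundary, the successor of the even
  piece's position belongs to the same target block, while the next odd piece goes to a different
  one.\<close>

lemma separating_block_perm: "separating (2 * N) (block_perm N)"
  unfolding separating_def
proof (intro allI impI)
  fix i assume "1 \<le> i \<and> i \<le> 2 * N - 1"
  then have i: "i \<in> {1..2 * N}" and i': "i < 2 * N"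
    by auto
  from i show "block_perm N (i + 1) \<noteq> block_perm N i + 1"
  proof (cases rule: block_index_cases)
    case (1 t)
    then show ?thesis
      by (simp add: block_perm_simps)
  next
    case (2 t)
    then have t: "Suc t < N"
      using i' by simp
    have "Suc (Suc t) mod N \<noteq> Suc t mod N"
      using t by (auto simp: mod_Suc)
    moreover have "block_perm N (Suc (Suc (Suc (2 * t)))) = 2 * (Suc (Suc t) mod N) + 2"
      using block_perm_simps(1)[OF t] by simp
    ultimately show ?thesis
      using 2 by (simp add: block_perm_simps)
  qed
qed

lemma sum_pairs:
  fixes f :: "nat \<Rightarrow> 'a::comm_monoid_add"
  shows "(\<Sum>i=1..2 * N. f i) = (\<Sum>t<N. f (Suc (2 * t)) + f (Suc (Suc (2 * t))))"
  by (induction N) (simp_all add: add.assoc)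

text \<open>Each target block further left contributes \<open>1 / N\<close>. Inside the target block
  only the second position (\<open>r = 2\<close>) has something before it, namely the even piece of
  block \<open>s\<close>.\<close>

lemma sum_block_len_before:
  assumes s: "s < N" and r: "r = 1 \<or> r = 2"
  shows "(\<Sum>i\<in>{i\<in>{1..2 * N}. block_perm N i < 2 * (Suc s mod N) + r}. block_len N a i) =
    (real (Suc s mod N) + (if r = 2 then a s else 0)) / real N"
proof -
  let ?q = "2 * (Suc s mod N) + r"
  let ?g = "\<lambda>p. if p < Suc s mod N then 1 / real N else 0"
  have "(\<Sum>i\<in>{i\<in>{1..2 * N}. block_perm N i < ?q}. block_len N a i) =
      (\<Sum>i=1..2 * N. if block_perm N i < ?q then block_len N a i else 0)"
    by (rule sum.inter_filter) simp
  also have "\<dots> = (\<Sum>t<N. ?g (Suc t mod N) + (if t = s then (if r = 2 then a s else 0) / real N else 0))"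
    unfolding sum_pairs
  proof (rule sum.cong)
    fix t assume "t \<in> {..<N}"
    then have t: "t < N"
      by simp
    let ?b = "\<lambda>i. if block_perm N i < ?q then block_len N a i else 0"
    consider "Suc t mod N < Suc s mod N" | "t = s" | "t \<noteq> s" "Suc t mod N > Suc s mod N"
      using Suc_mod_inj[OF t s] by linarith
    then show "?b (Suc (2 * t)) + ?b (Suc (Suc (2 * t))) =
        ?g (Suc t mod N) + (if t = s then (if r = 2 then a s else 0) / real N else 0)"
    proof cases
      case 1
      then have "t \<noteq> s" "2 * (Suc t mod N) + 2 < ?q" "2 * (Suc t mod N) + 1 < ?q"
        using r by auto
      then show ?thesis
        using 1 by (simp add: block_perm_simps[OF t] add_divide_distrib[symmetric])
    next
      case 2
      then show ?thesis
        using r by (auto simp: block_perm_simps[OF s])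
    next
      case 3
      then have "\<not> 2 * (Suc t mod N) + 2 < ?q" "\<not> 2 * (Suc t mod N) + 1 < ?q"
        using r by auto
      then show ?thesis
        using 3 by (simp add: block_perm_simps[OF t])
    qed
  qed simp
  \<comment> \<open>The cyclic shift is a reindexing, so it suffices to count the blocks below
    \<open>Suc s mod N\<close>.\<close>
  also have "\<dots> = (\<Sum>t<N. ?g t) + (if r = 2 then a s else 0) / real N"
    using s sum_Suc_mod[where g = ?g and N = N] by (simp add: sum.distrib)
  also have "(\<Sum>t<N. ?g t) = (\<Sum>t<Suc s mod N. 1 / real N)"
    using s mod_less_divisor[of N "Suc s"] by (intro sum.mono_neutral_cong_right) auto
  finally show ?thesis
    by (simp add: add_divide_distrib)
qed

text \<open>On an odd piece \<open>u + a t\<close> stays below 1, on an even piece it wraps around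
  once, so both are translations. Leaving \<open>m\<close> and \<open>\<pi>\<close> open and
  allowing angle 0 lets the even and the odd case share this argument.\<close>

lemma block_rot_eq_iet:
  assumes iet: "iet_data m \<pi> (block_len N a)" and m: "m \<le> 2 * N"
    and a: "\<And>t. t < N \<Longrightarrow> 0 \<le> a t \<and> a t < 1"
    and before: "\<And>j. j \<in> {1..m} \<Longrightarrow>
      (\<Sum>i\<in>{i\<in>{1..m}. \<pi> i < \<pi> j}. block_len N a i) =
      (\<Sum>i\<in>{i\<in>{1..2 * N}. block_perm N i < block_perm N j}. block_len N a i)"
  shows "block_rot N a = iet m \<pi> (block_len N a)"
proof
  fix x
  show "block_rot N a x = iet m \<pi> (block_len N a) x"
  proof (cases "x \<in> {0..<1}")
    case False
    then show ?thesis
      by (auto simp: block_rot_def iet_def)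
  next
    case True
    obtain j where j: "j \<in> {1..m}" and xj: "x \<in> iet_interval (block_len N a) j"
      using iet_interval_cover[OF iet True] .
    have iet_x: "iet m \<pi> (block_len N a) x = x - iet_beta (block_len N a) (j - 1) +
        (\<Sum>i\<in>{i\<in>{1..2 * N}. block_perm N i < block_perm N j}. block_len N a i)"
      using iet_on_interval[OF iet j xj] before[OF j] by simp
    have "j \<in> {1..2 * N}"
      using j m by auto
    then show ?thesis
    proof (cases rule: block_index_cases)
      case (1 t)
      define u where "u = real N * x - real t"
      have x: "x = (real t + u) / real N"
        using 1 by (simp add: u_def)
      have u: "0 \<le> u" "u < 1 - a t"
        using xj 1 unfolding x
        by (simp_all add: iet_interval_def iet_beta_block_len iet_beta_block_len_odd divide_right_mono divide_le_cancel divide_less_cancel)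
      have "frac (u + a t) = u + a t"
        using u a[OF 1(1)] by (simp add: frac_eq)
      moreover have "u < 1"
        using u a[OF 1(1)] by simp
      ultimately have "block_rot N a x = (real (Suc t mod N) + (u + a t)) / real N"
        using block_rot_coords[OF 1(1) u(1), of a] by (simp add: x)
      also have "\<dots> = x - real t / real N + (real (Suc t mod N) + a t) / real N"
        by (simp add: x add_divide_distrib)
      also have "\<dots> = iet m \<pi> (block_len N a) x"
        using sum_block_len_before[of t N 2 a] 1
        by (simp add: iet_x block_perm_simps iet_beta_block_len)
      finally show ?thesis .
    next
      case (2 t)
      define u where "u = real N * x - real t"
      have x: "x = (real t + u) / real N"
        using 2 by (simp add: u_def)
      have "iet_beta (block_len N a) (Suc (Suc (2 * t))) = real (Suc t) / real N"
        using iet_beta_block_len[of N a "Suc t"] by simp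
      then have u: "1 - a t \<le> u" "u < 1"
        using xj 2 unfolding x
        by (simp_all add: iet_interval_def iet_beta_block_len_odd divide_right_mono divide_le_cancel divide_less_cancel)
      have "frac (u + a t) = u + a t - 1"
        using u a[OF 2(1)] by (subst frac_unique_iff) simp
      moreover have "0 \<le> u"
        using u a[OF 2(1)] by simp
      ultimately have "block_rot N a x = (real (Suc t mod N) + (u + a t - 1)) / real N"
        using block_rot_coords[OF 2(1) _ u(2), of a] by (simp add: x)
      also have "\<dots> = x - (real t + (1 - a t)) / real N + real (Suc t mod N) / real N"
        by (simp add: x add_divide_distrib diff_divide_distrib)
      also have "\<dots> = iet m \<pi> (block_len N a) x"
        using sum_block_len_before[of t N 1 a] 2
        by (simp add: iet_x block_perm_simps iet_beta_block_len_odd)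
      finally show ?thesis .
    qed
  qed
qed

lemma iet_data_block_len:
  assumes "N > 0" and a: "\<And>t. t < N \<Longrightarrow> 0 < a t \<and> a t < 1"
  shows "iet_data (2 * N) (block_perm N) (block_len N a)"
  unfolding iet_data_def
proof (intro conjI ballI)
  show "(\<Sum>i=1..2 * N. block_len N a i) = 1"
    using iet_beta_block_len[of N a N] assms(1) by (simp add: iet_beta_def)
  fix i assume "i \<in> {1..2 * N}"
  then show "block_len N a i > 0"
    by (cases rule: block_index_cases) (use a in auto)
qed (use assms(1) block_perm_permutes in auto)

lemma block_rot_even:
  assumes "N > 0" "\<And>t. t < N \<Longrightarrow> 0 < a t \<and> a t < 1"
  shows "block_rot N a = iet (2 * N) (block_perm N) (block_len N a)"
  by (rule block_rot_eq_iet[OF iet_data_block_len]) (use assms in \<open>auto intro: less_imp_le\<close>)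

text \<open>When the rotation of the last block is trivial, its second interval, which the permutation
  sends to the first position, has length zero and can be dropped.\<close>

definition block_perm_odd :: "nat \<Rightarrow> nat \<Rightarrow> nat" where
  "block_perm_odd N i = (if i \<in> {1..2 * N - 1} then block_perm N i - 1 else i)"

lemma block_perm_last: "N > 0 \<Longrightarrow> block_perm N (2 * N) = 1"
  using block_perm_simps(2)[of "N - 1" N] by (cases N) auto

text \<open>The value 1 is already taken at \<open>2 * N\<close>. Hence the truncated subtraction in
  \<open>block_perm_odd\<close> is a true shift, preserving order and injectivity.\<close>

lemma block_perm_gt_1:
  assumes "N > 0" "i \<in> {1..2 * N - 1}"
  shows "block_perm N i > 1"
proof -
  have perm: "block_perm N permutes {1..2 * N}"
    using assms(1) by (rule block_perm_permutes)
  have "block_perm N i \<in> {1..2 * N}"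
    using permutes_in_image[OF perm, of i] assms(2) by auto
  moreover have "block_perm N i \<noteq> block_perm N (2 * N)"
    using injD[OF permutes_inj[OF perm], of i "2 * N"] assms by auto
  ultimately show ?thesis
    using block_perm_last[OF assms(1)] by auto
qed

lemma block_perm_odd_permutes:
  assumes "N > 0"
  shows "block_perm_odd N permutes {1..2 * N - 1}"
proof (rule bij_imp_permutes)
  have perm: "block_perm N permutes {1..2 * N}"
    using assms by (rule block_perm_permutes)
  have "inj_on (block_perm_odd N) {1..2 * N - 1}"
  proof (rule inj_onI)
    fix i j assume ij: "i \<in> {1..2 * N - 1}" "j \<in> {1..2 * N - 1}" "block_perm_odd N i = block_perm_odd N j"
    then have "block_perm N i = block_perm N j"
      using block_perm_gt_1[OF assms ij(1)] block_perm_gt_1[OF assms ij(2)] by (simp add: block_perm_odd_def)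
    then show "i = j"
      using injD[OF permutes_inj[OF perm]] by blast
  qed
  moreover
  have "block_perm_odd N i \<in> {1..2 * N - 1}" if "i \<in> {1..2 * N - 1}" for i
    using block_perm_gt_1[OF assms that] permutes_in_image[OF perm, of i] that
    by (auto simp: block_perm_odd_def)
  then have "block_perm_odd N ` {1..2 * N - 1} \<subseteq> {1..2 * N - 1}"
    by blast
  ultimately show "bij_betw (block_perm_odd N) {1..2 * N - 1} {1..2 * N - 1}"
    using endo_inj_surj[of "{1..2 * N - 1}" "block_perm_odd N"] by (simp add: bij_betw_def)
qed (auto simp: block_perm_odd_def)

lemma separating_block_perm_odd:
  assumes "N > 0"
  shows "separating (2 * N - 1) (block_perm_odd N)"
  unfolding separating_def
proof (intro allI impI)
  fix i assume i: "1 \<le> i \<and> i \<le> 2 * N - 1 - 1"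
  then have i': "i \<in> {1..2 * N - 1}" "i + 1 \<in> {1..2 * N - 1}"
    by auto
  have "block_perm N (i + 1) \<noteq> block_perm N i + 1"
    using separating_block_perm[of N] i i'(1) unfolding separating_def by auto
  then show "block_perm_odd N (i + 1) \<noteq> block_perm_odd N i + 1"
    using block_perm_gt_1[OF assms i'(1)] block_perm_gt_1[OF assms i'(2)] i' by (simp add: block_perm_odd_def)
qed

lemma iet_data_block_len_odd:
  assumes N: "N > 0" and a: "\<And>t. t < N - 1 \<Longrightarrow> 0 < a t \<and> a t < 1" "a (N - 1) = 0"
  shows "iet_data (2 * N - 1) (block_perm_odd N) (block_len N a)"
  unfolding iet_data_def
proof (intro conjI ballI)
  \<comment> \<open>The partition point of index \<open>2 * N - 1\<close> is
    \<open>((N - 1) + (1 - 0)) / N = 1\<close>.\<close>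
  have "Suc (2 * (N - 1)) = 2 * N - 1"
    using N by simp
  then show "(\<Sum>i=1..2 * N - 1. block_len N a i) = 1"
    using iet_beta_block_len_odd[of N a "N - 1"] N a(2) by (simp add: iet_beta_def)
  fix i assume i: "i \<in> {1..2 * N - 1}"
  then have "i \<in> {1..2 * N}"
    by auto
  then show "block_len N a i > 0"
  proof (cases rule: block_index_cases)
    case (1 t)
    have "a t < 1"
      using a(1)[of t] a(2) 1(1) by (cases "t = N - 1") auto
    then show ?thesis
      using 1 by simp
  next
    case (2 t)
    then have "t < N - 1"
      using i by simp
    then show ?thesis
      using 2 a by simp
  qed
qed (use N block_perm_odd_permutes in auto)

lemma block_rot_odd:
  assumes N: "N > 0" and a: "\<And>t. t < N - 1 \<Longrightarrow> 0 < a t \<and> a t < 1" "a (N - 1) = 0"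
  shows "block_rot N a = iet (2 * N - 1) (block_perm_odd N) (block_len N a)"
proof (rule block_rot_eq_iet[OF iet_data_block_len_odd])
  show "0 \<le> a t \<and> a t < 1" if "t < N" for t
  proof (cases "t = N - 1")
    case True
    then show ?thesis using a by simp
  next
    case False
    then have "t < N - 1" using that by simp
    then show ?thesis using a(1) by (auto intro: less_imp_le)
  qed
  fix j assume j: "j \<in> {1..2 * N - 1}"
  have last: "block_len N a (2 * N) = 0"
  proof -
    have "(2 * N - 1) div 2 = N - 1"
      using N by linarith
    then show ?thesis
      using a(2) by (simp add: block_len_def)
  qed
  have iff: "block_perm_odd N i < block_perm_odd N j \<longleftrightarrow> block_perm N i < block_perm N j"
    if "i \<in> {1..2 * N - 1}" for i
    using block_perm_gt_1[OF N that] block_perm_gt_1[OF N j] that j by (auto simp: block_perm_odd_def)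
  show "(\<Sum>i\<in>{i\<in>{1..2 * N - 1}. block_perm_odd N i < block_perm_odd N j}. block_len N a i) =
      (\<Sum>i\<in>{i\<in>{1..2 * N}. block_perm N i < block_perm N j}. block_len N a i)"
  proof (rule sum.mono_neutral_left)
    show "\<forall>i\<in>{i\<in>{1..2 * N}. block_perm N i < block_perm N j} -
        {i\<in>{1..2 * N - 1}. block_perm_odd N i < block_perm_odd N j}. block_len N a i = 0"
    proof
      fix i assume i: "i \<in> {i\<in>{1..2 * N}. block_perm N i < block_perm N j} -
        {i\<in>{1..2 * N - 1}. block_perm_odd N i < block_perm_odd N j}"
      then have "i \<notin> {1..2 * N - 1}"
        using iff by blast
      then have "i = 2 * N"
        using i by auto
      then show "block_len N a i = 0"
        using last by simp
    qed
    show "{i\<in>{1..2 * N - 1}. block_perm_odd N i < block_perm_odd N j} \<subseteq>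
        {i\<in>{1..2 * N}. block_perm N i < block_perm N j}"
      using iff by auto
  qed simp
qed (use assms in auto)

subsection \<open>Rationally independent angles\<close>

text \<open>Each new generator enlarges the span to at most an image of its product with the
  rationals. An interval of reals therefore always contains a point outside such a span.\<close>

lemma countable_rat_span:
  assumes "finite B"
  shows "countable (rat_real.span B)"
  using assms
proof induction
  case (insert a B)
  have "rat_real.span (insert a B) \<subseteq> (\<lambda>(k, y). y + of_rat k * a) ` (UNIV \<times> rat_real.span B)"
    unfolding rat_real.span_insert by (force simp: image_iff)
  moreover have "countable ((\<lambda>(k, y). y + of_rat k * a) ` (UNIV \<times> rat_real.span B))"
    using insert.IH by (intro countable_image countable_SIGMA) auto
  ultimately show ?case
    by (rule countable_subset)
qed simp

text \<open>Angles are chosen one at a time, each outside the countable span of 1 and the earlier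
  ones.\<close>

lemma rat_independent_angles:
  "\<exists>a. (\<forall>i<c. 0 < a i \<and> a i < 1) \<and> inj_on a {..<c} \<and> rat_real.independent (insert 1 (a ` {..<c::nat}))"
proof (induction c)
  case 0
  then show ?case
    by simp
next
  case (Suc c)
  then obtain a where a: "\<forall>i<c. 0 < a i \<and> a i < 1" "inj_on a {..<c}"
    "rat_real.independent (insert 1 (a ` {..<c}))"
    by blast
  let ?B = "insert 1 (a ` {..<c})"
  have "\<not> {0<..<1} \<subseteq> rat_real.span ?B"
    using countable_rat_span[of ?B] uncountable_open_interval[of 0 "1::real"] countable_subset by auto
  then obtain y where "y \<in> {0<..<1}" and y_span: "y \<notin> rat_real.span ?B"
    by blast
  then have y: "0 < y" "y < 1"
    by simp_all
  have "y \<notin> a ` {..<c}"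
    using y_span rat_real.span_base[of y ?B] by blast
  moreover have "rat_real.independent (insert y ?B)"
    using y_span a(3) by (rule rat_real.independent_insertI)
  moreover define a' where "a' = a(c := y)"
  have a': "a' c = y" "\<And>i. i < c \<Longrightarrow> a' i = a i"
    by (auto simp: a'_def)
  have "a' ` {..<Suc c} = insert y (a ` {..<c})"
    using a' by (force simp: lessThan_Suc)
  moreover have "inj_on a' {..<c}"
    using a(2) a'(2) by (simp add: inj_on_def)
  moreover have "a' ` {..<c} = a ` {..<c}"
    using a'(2) by simp
  moreover have "\<forall>i<Suc c. 0 < a' i \<and> a' i < 1"
    using a(1) y a' by (auto simp: less_Suc_eq)
  ultimately show ?case
    using a'(1) by (intro exI[of _ a']) (simp add: lessThan_Suc insert_commute)
qed

text \<open>If the combination equals a rational \<open>r\<close>, giving 1 the coefficient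
  \<open>- r\<close> yields a linear relation. This is the source of all irrationality claims
  below.\<close>

lemma rat_independent_coeff_zero:
  assumes ind: "rat_real.independent (insert 1 (a ` {..<c::nat}))" and inj: "inj_on a {..<c}"
    and one: "1 \<notin> a ` {..<c}"
    and sum: "(\<Sum>i<c. of_rat (q i) * a i) \<in> \<rat>" and i: "i < c"
  shows "q i = 0"
proof -
  obtain r where r: "(\<Sum>i<c. of_rat (q i) * a i) = of_rat r"
    using sum by (auto elim: Rats_cases)
  define u where "u v = (if v = 1 then - r else q (inv_into {..<c} a v))" for v
  have u: "u (a i) = q i" if "i < c" for i
    using that one inj by (auto simp: u_def)
  have "(\<Sum>v\<in>insert 1 (a ` {..<c}). of_rat (u v) * v) = of_rat (u 1) + (\<Sum>v\<in>a ` {..<c}. of_rat (u v) * v)"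
    using one by simp
  also have "(\<Sum>v\<in>a ` {..<c}. of_rat (u v) * v) = (\<Sum>i<c. of_rat (q i) * a i)"
    using u by (simp add: sum.reindex[OF inj])
  also have "of_rat (u 1) + \<dots> = 0"
    by (simp add: r u_def of_rat_minus)
  finally have "u (a i) = 0"
    using i by (intro rat_real.independentD[OF ind]) auto
  then show ?thesis
    using u i by simp
qed

text \<open>Up to the rational factor \<open>1 / N\<close>, the lengths span the same space as 1 and
  the angles: even pieces give the \<open>a t\<close> with \<open>t < c\<close>, and the first two
  pieces together give 1.\<close>

lemma dim_block_len:
  assumes c: "1 \<le> c" "2 * c \<le> m" "m \<le> 2 * N"
    and a0: "\<And>t. c \<le> t \<Longrightarrow> a t = 0"
    and ind: "rat_real.independent (insert 1 (a ` {..<c}))" and inj: "inj_on a {..<c}"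
    and one: "1 \<notin> a ` {..<c}"
  shows "rat_real.dim (block_len N a ` {1..m}) = 1 + c"
proof -
  let ?B = "insert 1 (a ` {..<c})" and ?S = "block_len N a ` {1..m}"
  have N: "N > 0"
    using c by simp
  have scale_N: "x / real N \<in> rat_real.span V \<Longrightarrow> x \<in> rat_real.span V" for x V
    using rat_real.span_scale[of "x / real N" V "of_nat N"] N by simp
  have div_N: "x \<in> rat_real.span V \<Longrightarrow> x / real N \<in> rat_real.span V" for x V
    using rat_real.span_scale[of x V "1 / of_nat N"] by (simp add: of_rat_divide)
  have aB: "a t \<in> rat_real.span ?B" for t
  proof (cases "t < c")
    case True
    then show ?thesis
      by (intro rat_real.span_base) simp
  next
    case False
    then show ?thesis
      using a0[of t] rat_real.span_zero[of ?B] by simp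
  qed
  have one_B: "1 \<in> rat_real.span ?B"
    by (intro rat_real.span_base) simp
  have "?S \<subseteq> rat_real.span ?B"
  proof
    fix x assume "x \<in> ?S"
    then obtain i where "i \<in> {1..m}" and x: "x = block_len N a i"
      by blast
    then have "i \<in> {1..2 * N}"
      using c by auto
    then show "x \<in> rat_real.span ?B"
    proof (cases rule: block_index_cases)
      case (1 t)
      then show ?thesis
        unfolding x 1(2) block_len_simps by (intro div_N rat_real.span_diff one_B aB)
    next
      case (2 t)
      then show ?thesis
        unfolding x 2(2) block_len_simps by (intro div_N aB)
    qed
  qed
  moreover have aS: "a t \<in> rat_real.span ?S" if "t < c" for t
  proof (rule scale_N)
    have "block_len N a (Suc (Suc (2 * t))) \<in> ?S"
      using that c by (intro imageI) auto
    then show "a t / real N \<in> rat_real.span ?S"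
      unfolding block_len_simps by (rule rat_real.span_base)
  qed
  moreover have "1 \<in> rat_real.span ?S"
  proof -
    have "block_len N a (Suc (2 * 0)) \<in> ?S"
      using c by (intro imageI) auto
    then have "(1 - a 0) / real N \<in> rat_real.span ?S"
      unfolding block_len_simps by (rule rat_real.span_base)
    then have "1 - a 0 \<in> rat_real.span ?S"
      by (rule scale_N)
    then have "1 - a 0 + a 0 \<in> rat_real.span ?S"
      using aS[of 0] c by (intro rat_real.span_add) auto
    then show ?thesis
      by simp
  qed
  ultimately have "rat_real.span ?B = rat_real.span ?S"
    unfolding rat_real.span_eq by blast
  from rat_real.dim_eq_card[OF this ind] show ?thesis
    using one by (simp add: card_image[OF inj])
qed

section \<open>Choice of the angles and verification of minimality, root and rank\<close>

theorem mainTheorem6: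
  fixes m :: nat
  assumes "m \<ge> 2"
  shows "\<exists>\<pi> lam T. iet_data m \<pi> lam \<and> T = iet m \<pi> lam \<and> separating m \<pi> \<and> minimal_iet T \<and>
           (\<exists>n::nat. n \<ge> 2 \<and> has_root n T) \<and> iet_rank T = 1 + m div 2"
proof -
  \<comment> \<open>\<open>c\<close> counts the nonzero angles and \<open>N\<close> the blocks:
    \<open>c = N\<close> for even \<open>m\<close>, and \<open>c = N - 1\<close> for odd
    \<open>m\<close>, where the last block gets angle 0.\<close>
  define c where "c = m div 2"
  define N where "N = Suc m div 2"
  have c: "1 \<le> c" "c \<le> N" "2 * c \<le> m" "m \<le> 2 * N" and N: "N > 0"
    using assms by (auto simp: c_def N_def)
  obtain \<alpha> where \<alpha>: "\<And>i. i < c \<Longrightarrow> 0 < \<alpha> i \<and> \<alpha> i < 1" "inj_on \<alpha> {..<c}"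
    "rat_real.independent (insert 1 (\<alpha> ` {..<c}))"
    using rat_independent_angles[of c] by blast
  define a where "a i = (if i < c then \<alpha> i else 0)" for i
  have a: "0 < a i" "a i < 1" if "i < c" for i
    using \<alpha>(1)[OF that] that by (auto simp: a_def)
  have a0: "a i = 0" if "c \<le> i" for i
    using that by (simp add: a_def)
  have inj: "inj_on a {..<c}"
    using \<alpha>(2) by (simp add: inj_on_def a_def)
  have "a ` {..<c} = \<alpha> ` {..<c}"
    by (simp add: a_def)
  with \<alpha>(3) have ind: "rat_real.independent (insert 1 (a ` {..<c}))"
    by simp
  have one: "1 \<notin> a ` {..<c}"
    using a by force
  note coeff_zero = rat_independent_coeff_zero[OF ind inj one]
  have sum_a: "(\<Sum>i<N. a i) = (\<Sum>i<c. a i)"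
    using c(2) a0 by (intro sum.mono_neutral_right) auto

  obtain \<pi> where iet: "iet_data m \<pi> (block_len N a)" and sep: "separating m \<pi>"
    and T: "block_rot N a = iet m \<pi> (block_len N a)"
  proof (cases "even m")
    case True
    then have "m = 2 * N" "c = N"
      by (auto simp: c_def N_def)
    with that[of "block_perm N"] show ?thesis
      using N a iet_data_block_len[of N a] separating_block_perm[of N] block_rot_even[of N a] by simp
  next
    case False
    then have "m = 2 * N - 1" "c = N - 1"
      by (auto simp: c_def N_def elim!: oddE)
    with that[of "block_perm_odd N"] show ?thesis
      using N a a0 iet_data_block_len_odd[of N a] separating_block_perm_odd[of N] block_rot_odd[of N a]
      by simp
  qed

  have "(\<Sum>i<N. a i) \<notin> \<rat>"
    using coeff_zero[of "\<lambda>_. 1" 0] c(1) by (auto simp: sum_a)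
  then have min: "minimal_iet (block_rot N a)"
    using N by (intro minimal_block_rot)

  define b where "b j = a j - (\<Sum>i<N. a i) / real (Suc N)" for j
  have "b j \<notin> \<rat>" for j
  proof
    assume "b j \<in> \<rat>"
    \<comment> \<open>These are the coefficients of \<open>b j\<close> in the angles. The one at
      \<open>i = 0\<close> is \<open>1 - 1 / (N + 1)\<close> or \<open>- 1 / (N + 1)\<close>,
      nonzero in both cases because \<open>N > 0\<close>; this also covers blocks with angle
      0.\<close>
    let ?q = "\<lambda>i. (if i = j then 1 else 0) - 1 / of_nat (Suc N) :: rat"
    have "(\<Sum>i<c. of_rat (?q i) * a i) =
        (\<Sum>i<c. (if i = j then a i else 0) - a i / real (Suc N))"
      by (intro sum.cong) (auto simp: of_rat_diff of_rat_divide of_rat_add algebra_simps)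
    also have "\<dots> = b j"
      using a0[of j] by (simp add: b_def sum_a sum_subtractf sum_divide_distrib[symmetric])
    finally have "?q 0 = 0"
      using \<open>b j \<in> \<rat>\<close> c(1) by (intro coeff_zero) auto
    then show False
      using N by (auto split: if_splits)
  qed
  \<comment> \<open>No lowered angle is an integer, so both pieces of every block are nondegenerate
    and the root exchanges \<open>2 * N\<close> intervals even when \<open>m\<close> is odd.\<close>
  then have "frac (b j) > 0" for j
    using Ints_subset_Rats by auto
  then have "iet_data (2 * N) (block_perm N) (block_len N (\<lambda>j. frac (b j)))"
    and "block_rot N (\<lambda>j. frac (b j)) = iet (2 * N) (block_perm N) (block_len N (\<lambda>j. frac (b j)))"
    using N by (intro iet_data_block_len block_rot_even; simp add: frac_lt_1)+
  then have "block_rot N b \<in> IETs"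
    unfolding IETs_def block_rot_frac by blast
  moreover have "block_rot N a = block_rot N b ^^ Suc N"
    by (rule block_rot_root[symmetric]) (simp add: b_def)
  ultimately have "has_root (Suc N) (block_rot N a)"
    unfolding has_root_def by blast
  then have root: "\<exists>n\<ge>2. has_root n (block_rot N a)"
    using N by (intro exI[of _ "Suc N"]) simp

  have "iet_rank (block_rot N a) = 1 + m div 2"
    using iet_rank_iet[OF iet sep] dim_block_len[OF c(1,3,4) a0 ind inj one] by (simp add: T c_def)
  with iet T sep min root show ?thesis
    by (intro exI[of _ \<pi>] exI[of _ "block_len N a"] exI[of _ "block_rot N a"] conjI)
qed

end
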